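(* For $n\ge1$ and $m\ge n$ let $$x(n)=\lim_{k\to\infty}\tau_n^k(n)\,.\,n\,0\,n\,\tau_n(0n)\dots\tau_n^i(0n)\dots\in X_n,$$ $$y(m,n)=\lim_{k\to\infty}\tau_m^k(m)\,.\,(n-1)\,0\,n\,\tau_m(0n)\dots\tau_m^i(0n)\dots\in X_m,$$ where the symbol after the dot is the zero coordinate, and let $$S=\bigcup_{n\ge2}\{(x(1),\dots,x(n-1),y(n,n),y(n+1,n),y(n+2,n),\dots)\}\subset X.$$ Then the countable set $S$ is a scrambled set of $(X,T)$.
   Context: For $n\ge1$ let $A_n=\{0,\dots,n\}$ and let $\tau_n:A_n\to A_n^3$ be the primitive substitution $\tau_n(a)=a\,0\,(a+1)$ if $a\ne n$ and $\tau_n(n)=n\,0\,n$, extended to finite words by concatenation. Since $\tau_n(n)$ ends with $n$, the words $\tau_n^k(n)$ are successive suffixes of one another and $\lim_{k\to\infty}\tau_n^k(n)$ placed to the left of the dot denotes the resulting left-infinite sequence. $X_n$ is the smallest subshift (closed shift-invariant subset) of $A_n^{\mathbb Z}$ in which all words $\tau_n^k(a)$, $k\ge0$, $a\in A_n$, appear. $T_n$ is the shift $T_n((x_i)_i)=(x_{i+1})_i$ on $X_n$. Let $\rho_n:A_{n+1}\to A_n$, $\rho_n(a)=a$ if $a\ne n+1$ and $\rho_n(n+1)=n$; applied coordinatewise it defines a factor map $\rho_n:X_{n+1}\to X_n$. Let $$X=\{(x_n)_{n\ge1}\in\prod_{n\ge1}X_n:\ \rho_n(x_{n+1})=x_n\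 \ \forall n\ge1\},\qquad T((x_n)_{n\ge1})=(T_n(x_n))_{n\ge1},$$ with a metric $\varrho$ compatible with the product topology. A pair $\{x,y\}\subseteq X$ is a Li–Yorke pair if $\limsup_{k\to\infty}\varrho(T^kx,T^ky)>0$ and $\liminf_{k\to\infty}\varrho(T^kx,T^ky)=0$. A set $S\subseteq X$ is scrambled if any pair of distinct points of $S$ is a Li–Yorke pair. *)

theory Defs
  imports "HOL-Analysis.Analysis"
begin

section \<open>The substitution subshifts \<open>X\<^sub>n\<close>\<close>

definition alph :: "nat \<Rightarrow> nat set" where
  "alph n = {0..n}"

definition tau_letter :: "nat \<Rightarrow> nat \<Rightarrow> nat list" where
  "tau_letter n a = (if a \<noteq> n then [a, 0, a + 1] else [n, 0, n])"

definition tau :: "nat \<Rightarrow> nat list \<Rightarrow> nat list" where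
  "tau n w = concat (map (tau_letter n) w)"

definition full_shift :: "nat \<Rightarrow> (int \<Rightarrow> nat) topology" where
  "full_shift n = product_topology (\<lambda>_. discrete_topology (alph n)) UNIV"

definition shift :: "(int \<Rightarrow> nat) \<Rightarrow> int \<Rightarrow> nat" where
  "shift x = (\<lambda>i. x (i + 1))"

text \<open>Shift-invariance of a two-sided subshift means that \<open>Y\<close> is equal to its image under
  the shift; forward invariance alone would not suffice.\<close>

definition subshift :: "nat \<Rightarrow> (int \<Rightarrow> nat) set \<Rightarrow> bool" where
  "subshift n Y \<longleftrightarrow> closedin (full_shift n) Y \<and> shift ` Y = Y"

definition appears_in :: "nat list \<Rightarrow> (int \<Rightarrow> nat) set \<Rightarrow> bool" where
  "appears_in w Y \<longleftrightarrow> (\<exists>x\<in>Y. \<exists>i. \<forall>j<length w. x (i + int j) = w ! j)"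

text \<open>The smallest subshift in which all \<open>\<tau>\<^sub>n\<^sup>k(a)\<close> appear, as the intersection of all such
  subshifts.  For \<open>n \<ge> 1\<close> the words still appear in the intersection because \<open>\<tau>\<^sub>n\<close> is primitive.\<close>

definition Xn :: "nat \<Rightarrow> (int \<Rightarrow> nat) set" where
  "Xn n = \<Inter> {Y. subshift n Y \<and> (\<forall>k. \<forall>a\<in>alph n. appears_in ((tau n ^^ k) [a]) Y)}"

section \<open>The inverse limit\<close>

definition rho :: "nat \<Rightarrow> nat \<Rightarrow> nat" where
  "rho n a = (if a \<noteq> n + 1 then a else n)"

text \<open>Points of the product over \<open>n \<ge> 1\<close> are extensional functions, i.e. \<open>undefined\<close> at index 0.\<close>

definition X_lim :: "(nat \<Rightarrow> int \<Rightarrow> nat) set" where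
  "X_lim = {x \<in> (\<Pi>\<^sub>E n\<in>{1..}. Xn n). \<forall>n\<ge>1. rho n \<circ> x (n + 1) = x n}"

definition T_lim :: "(nat \<Rightarrow> int \<Rightarrow> nat) \<Rightarrow> nat \<Rightarrow> int \<Rightarrow> nat" where
  "T_lim x = (\<lambda>n\<in>{1..}. shift (x n))"

definition X_lim_topology :: "(nat \<Rightarrow> int \<Rightarrow> nat) topology" where
  "X_lim_topology =
     subtopology (product_topology (\<lambda>n. subtopology (full_shift n) (Xn n)) {1..}) X_lim"

section \<open>Scrambled sets\<close>

definition li_yorke :: "('a \<Rightarrow> 'a \<Rightarrow> real) \<Rightarrow> ('a \<Rightarrow> 'a) \<Rightarrow> 'a \<Rightarrow> 'a \<Rightarrow> bool" where
  "li_yorke d T x y \<longleftrightarrow>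
     limsup (\<lambda>k. ereal (d ((T ^^ k) x) ((T ^^ k) y))) > 0 \<and>
     liminf (\<lambda>k. ereal (d ((T ^^ k) x) ((T ^^ k) y))) = 0"

definition scrambled :: "'a set \<Rightarrow> ('a \<Rightarrow> 'a \<Rightarrow> real) \<Rightarrow> ('a \<Rightarrow> 'a) \<Rightarrow> 'a set \<Rightarrow> bool" where
  "scrambled X d T S \<longleftrightarrow> S \<subseteq> X \<and> (\<forall>x\<in>S. \<forall>y\<in>S. x \<noteq> y \<longrightarrow> li_yorke d T x y)"

section \<open>The points \<open>x(n)\<close>, \<open>y(m,n)\<close> and the set \<open>S\<close>\<close>

text \<open>Limits of words: \<open>left_lim u\<close> is the left-infinite limit of words that are successive
  suffixes of one another, read from right to left (index 0 is the last letter);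
  \<open>right_lim u\<close> is the right-infinite limit of words that are successive prefixes.\<close>

definition left_lim :: "(nat \<Rightarrow> nat list) \<Rightarrow> nat \<Rightarrow> nat" where
  "left_lim u j = (THE c. \<forall>\<^sub>F k in sequentially. j < length (u k) \<and> rev (u k) ! j = c)"

definition right_lim :: "(nat \<Rightarrow> nat list) \<Rightarrow> nat \<Rightarrow> nat" where
  "right_lim u j = (THE c. \<forall>\<^sub>F k in sequentially. j < length (u k) \<and> u k ! j = c)"

text \<open>The two-sided sequence \<open>l . r\<close>, with the first letter of \<open>r\<close> at coordinate 0 and the
  last letter of \<open>l\<close> at coordinate \<open>-1\<close>.\<close>

definition dotted :: "(nat \<Rightarrow> nat) \<Rightarrow> (nat \<Rightarrow> nat) \<Rightarrow> int \<Rightarrow> nat" where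
  "dotted l r i = (if i < 0 then l (nat (- i - 1)) else r (nat i))"

definition x_pt :: "nat \<Rightarrow> int \<Rightarrow> nat" where
  "x_pt n = dotted (left_lim (\<lambda>k. (tau n ^^ k) [n]))
     (right_lim (\<lambda>k. [n, 0, n] @ concat (map (\<lambda>i. (tau n ^^ i) [0, n]) [1..<Suc k])))"

definition y_pt :: "nat \<Rightarrow> nat \<Rightarrow> int \<Rightarrow> nat" where
  "y_pt m n = dotted (left_lim (\<lambda>k. (tau m ^^ k) [m]))
     (right_lim (\<lambda>k. [n - 1, 0, n] @ concat (map (\<lambda>i. (tau m ^^ i) [0, n]) [1..<Suc k])))"

definition S_set :: "(nat \<Rightarrow> int \<Rightarrow> nat) set" where
  "S_set = (\<Union>n\<in>{2..}. {\<lambda>m\<in>{1..}. if m < n then x_pt m else y_pt m n})"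

end

theory Submission
  imports Defs "HOL-Library.Sublist"
begin

text \<open>The right-hand rays in the definitions of \<open>x(n)\<close> and \<open>y(m,n)\<close> telescope: the ray of \<open>x(n)\<close> is the limit
  of the words \<open>\<tau>\<^sub>n\<^sup>k(n)\<close>, that of \<open>y(m,n)\<close> the limit of the words \<open>\<tau>\<^sub>m\<^sup>k(n-1)\<close>. Hence all these points
  belong to one family, the two-sided fixed points of \<open>\<tau>\<^sub>n\<close> with seed \<open>n.a\<close> (\<open>fixed_pt n a\<close>), with
  \<open>a = n\<close> for \<open>x(n)\<close> and \<open>a = n - 1\<close> in level \<open>m\<close> for \<open>y(m,n)\<close>. On the coordinates from \<open>-3\<^sup>k\<close> to
  \<open>3\<^sup>k - 1\<close> such a point reads \<open>\<tau>\<^sub>n\<^sup>k(na)\<close>, and the membership claims follow from this. The two-letter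
  word \<open>na\<close> occurs in an iterate of a letter (\<open>two_letter_word_occurs\<close>), so every subshift that
  contains the required words contains translates that agree with the fixed point on longer and
  longer windows, and contains the fixed point because it is closed. Since
  \<open>\<rho>\<^sub>n \<circ> \<tau>\<^sub>n\<^sub>+\<^sub>1 = \<tau>\<^sub>n \<circ> \<rho>\<^sub>n\<close> on words, \<open>\<rho>\<^sub>n\<close> sends the fixed point with seed \<open>(n+1).a\<close> to the one with seed
  \<open>n.\<rho>\<^sub>n(a)\<close>, which makes the elements of \<open>S\<close> points of the inverse limit.

  The Li--Yorke property comes from the decomposition \<open>\<tau>\<^sup>k\<^sup>+\<^sup>1(a) = \<tau>\<^sup>k(a) \<tau>\<^sup>k(0) \<tau>\<^sup>k(a+1)\<close>. The middle block
  does not depend on \<open>a\<close>: at the times \<open>3\<^sup>k + \<lfloor>3\<^sup>k / 2\<rfloor>\<close>, in the centre of this block, two elements of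
  \<open>S\<close> agree in every level on windows whose size tends to infinity. The last block starts with
  \<open>a + 1\<close>: at the times \<open>2 \<cdot> 3\<^sup>k\<close> the elements of \<open>S\<close> with indices \<open>n < n'\<close> show the letters
  \<open>n\<close> and \<open>n'\<close> at coordinate zero of level \<open>n'\<close>.

  To turn statements about coordinates into statements about an arbitrary compatible metric, one
  uses that the inverse limit is compact (\<open>compact_X_lim\<close>). Along either sequence of times, both
  orbits converge after passing to a subsequence, and the distances converge to the distance of the
  two limits (\<open>subsequence_limits\<close>). The limits coincide in the first case and differ at a
  coordinate in the second.\<close>

section \<open>Iterates of the substitution\<close>

lemma tau_append: "tau n (u @ v) = tau n u @ tau n v"
  by (simp add: tau_def)

lemma tau_pow_append: "(tau n ^^ k) (u @ v) = (tau n ^^ k) u @ (tau n ^^ k) v"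
  by (induction k) (simp_all add: tau_append)

lemma length_tau: "length (tau n w) = 3 * length w"
  by (induction w) (auto simp: tau_def tau_letter_def)

lemma length_tau_pow: "length ((tau n ^^ k) w) = 3 ^ k * length w"
  by (induction k) (simp_all add: length_tau)

lemma tau_single: "tau n [a] = [a, 0, if a \<noteq> n then a + 1 else n]"
  by (simp add: tau_def tau_letter_def)

text \<open>The three blocks of length \<open>3\<^sup>k\<close> behind everything that follows: the first gives convergence of
  the right-hand rays, the second agreement and the third disagreement of two such rays.\<close>

lemma tau_pow_Suc_single:
  "(tau n ^^ Suc k) [a] =
     (tau n ^^ k) [a] @ (tau n ^^ k) [0] @ (tau n ^^ k) [if a \<noteq> n then a + 1 else n]"
proof -
  have "(tau n ^^ Suc k) [a] = (tau n ^^ k) ([a] @ [0] @ [if a \<noteq> n then a + 1 else n])"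
    by (simp add: funpow_Suc_right tau_single del: funpow.simps)
  then show ?thesis by (simp only: tau_pow_append)
qed

lemma prefix_tau_pow:
  assumes "k \<le> l" shows "prefix ((tau n ^^ k) [a]) ((tau n ^^ l) [a])"
  using assms
  by (induction rule: dec_induct) (auto simp: tau_pow_Suc_single simp del: funpow.simps)

lemma suffix_tau_pow:
  assumes "k \<le> l" shows "suffix ((tau n ^^ k) [n]) ((tau n ^^ l) [n])"
  using assms
proof (induction rule: dec_induct)
  case (step l)
  have "suffix ((tau n ^^ l) [n]) ((tau n ^^ Suc l) [n])"
    by (auto simp: tau_pow_Suc_single suffix_def simp del: funpow.simps)
  then show ?case using step.IH suffix_order.trans by blast
qed simp

lemma set_tau_pow:
  assumes "set w \<subseteq> alph n" shows "set ((tau n ^^ k) w) \<subseteq> alph n"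
proof (induction k)
  case (Suc k)
  then show ?case by (auto simp: tau_def tau_letter_def alph_def)
qed (use assms in simp)

lemma tau_pow_hd: "\<exists>v. (tau n ^^ k) [a] = a # v"
  using prefix_tau_pow[of 0 k n a] by (auto simp: prefix_def)

lemma tau_pow_last:
  assumes "a \<le> n" shows "\<exists>u. (tau n ^^ k) [a] = u @ [min n (a + k)]"
  using assms
proof (induction k arbitrary: a)
  case (Suc k)
  define b where "b = (if a \<noteq> n then a + 1 else n)"
  have b: "b \<le> n" "min n (b + k) = min n (a + Suc k)"
    using Suc.prems by (auto simp: b_def)
  obtain u where u: "(tau n ^^ k) [b] = u @ [min n (a + Suc k)]"
    using Suc.IH[OF b(1)] b(2) by auto
  have "(tau n ^^ Suc k) [a] = ((tau n ^^ k) [a] @ (tau n ^^ k) [0] @ u) @ [min n (a + Suc k)]"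
    unfolding tau_pow_Suc_single b_def[symmetric] u by simp
  then show ?case by (rule exI)
qed simp

text \<open>Seen inside \<open>\<tau>(0)\<close> or \<open>\<tau>(a-1)\<close>, the word \<open>0a\<close> occurs. Applying \<open>\<tau>\<^sup>n\<close> raises the letter left of the
  boundary from \<open>0\<close> to \<open>n\<close>, because each application increments the last letter of a word until it
  reaches \<open>n\<close>, while the letter \<open>a\<close> right of the boundary does not change.\<close>

lemma two_letter_word_occurs:
  assumes "n \<ge> 1" "a \<le> n"
  shows "\<exists>K. \<exists>c\<in>alph n. sublist [n, a] ((tau n ^^ K) [c])"
proof -
  have "\<exists>c\<in>alph n. sublist [0, a] (tau n [c])"
  proof (cases a)
    case 0
    have "tau n [0] = [0, 0] @ [1]" using assms by (simp add: tau_single)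
    then have "sublist [0, 0] (tau n [0])" by (simp only: sublist_append_rightI)
    then show ?thesis unfolding 0 by (intro bexI[of _ 0]) (simp_all add: alph_def)
  next
    case (Suc b)
    have "tau n [b] = [b] @ [0, a]" using assms Suc by (simp add: tau_single)
    moreover have "b \<in> alph n" using assms Suc by (simp add: alph_def)
    ultimately show ?thesis by (intro bexI[of _ b]) (simp_all only: sublist_append_leftI)
  qed
  then obtain c ps ss where c: "c \<in> alph n" "tau n [c] = ps @ [0, a] @ ss"
    unfolding sublist_def by blast
  obtain u where u: "(tau n ^^ n) [0] = u @ [n]"
    using tau_pow_last[of 0 n n] by auto
  obtain v where v: "(tau n ^^ n) [a] = a # v" using tau_pow_hd by blast
  have "(tau n ^^ Suc n) [c] = (tau n ^^ n) (ps @ [0] @ [a] @ ss)"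
    using c by (simp add: funpow_Suc_right del: funpow.simps)
  also have "\<dots> = ((tau n ^^ n) ps @ u) @ [n, a] @ (v @ (tau n ^^ n) ss)"
    unfolding tau_pow_append u v by simp
  finally have "sublist [n, a] ((tau n ^^ Suc n) [c])" unfolding sublist_def by blast
  then show ?thesis using c(1) by blast
qed

section \<open>Two-sided fixed points\<close>

text \<open>For \<open>a \<le> n\<close> this is the fixed point of \<open>\<tau>\<^sub>n\<close> with the letters \<open>n\<close> and \<open>a\<close> at the coordinates
  \<open>-1\<close> and \<open>0\<close>.\<close>

definition fixed_pt :: "nat \<Rightarrow> nat \<Rightarrow> int \<Rightarrow> nat" where
  "fixed_pt n a = dotted (left_lim (\<lambda>k. (tau n ^^ k) [n])) (right_lim (\<lambda>k. (tau n ^^ k) [a]))"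

lemma right_lim_eqI:
  assumes "\<And>k. k \<ge> N \<Longrightarrow> j < length (u k) \<and> u k ! j = c"
  shows "right_lim u j = c"
  unfolding right_lim_def
proof (rule the_equality)
  show ev: "\<forall>\<^sub>F k in sequentially. j < length (u k) \<and> u k ! j = c"
    using assms eventually_sequentially by blast
  fix b assume "\<forall>\<^sub>F k in sequentially. j < length (u k) \<and> u k ! j = b"
  with ev have "\<forall>\<^sub>F k in sequentially. b = c" by eventually_elim auto
  then show "b = c" by simp
qed

lemma left_lim_eq_right_lim_rev: "left_lim u = right_lim (\<lambda>k. rev (u k))"
  by (simp add: left_lim_def right_lim_def fun_eq_iff)

lemma right_lim_tau_pow:
  assumes "j < 3 ^ k"
  shows "right_lim (\<lambda>k. (tau n ^^ k) [a]) j = (tau n ^^ k) [a] ! j"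
proof (rule right_lim_eqI)
  fix l assume "l \<ge> k"
  then obtain w where "(tau n ^^ l) [a] = (tau n ^^ k) [a] @ w"
    using prefix_tau_pow unfolding prefix_def by blast
  then show "j < length ((tau n ^^ l) [a]) \<and> (tau n ^^ l) [a] ! j = (tau n ^^ k) [a] ! j"
    using assms by (simp add: nth_append length_tau_pow)
qed

lemma left_lim_tau_pow:
  assumes "j < 3 ^ k"
  shows "left_lim (\<lambda>k. (tau n ^^ k) [n]) j = rev ((tau n ^^ k) [n]) ! j"
  unfolding left_lim_eq_right_lim_rev
proof (rule right_lim_eqI)
  fix l assume "l \<ge> k"
  then obtain w where "(tau n ^^ l) [n] = w @ (tau n ^^ k) [n]"
    using suffix_tau_pow unfolding suffix_def by blast
  then show "j < length (rev ((tau n ^^ l) [n])) \<and>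
      rev ((tau n ^^ l) [n]) ! j = rev ((tau n ^^ k) [n]) ! j"
    using assms by (simp add: nth_append length_tau_pow)
qed

text \<open>Both rays appear in a single finite word, so they can be treated together: occurrences
  of \<open>na\<close> become approximations of the fixed point, and letterwise maps can be applied to the word.\<close>

lemma fixed_pt_window:
  assumes "- (3 ^ k) \<le> i" "i < 3 ^ k"
  shows "fixed_pt n a i = (tau n ^^ k) [n, a] ! nat (i + 3 ^ k)"
proof -
  have split: "(tau n ^^ k) [n, a] = (tau n ^^ k) [n] @ (tau n ^^ k) [a]"
    using tau_pow_append[of k n "[n]" "[a]"] by simp
  have pow: "nat (3 ^ k) = (3::nat) ^ k" by (simp add: nat_power_eq)
  show ?thesis
  proof (cases "i < 0")
    case True
    have j: "nat (- i - 1) < 3 ^ k" using assms True pow by linarith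
    have lt: "nat (i + 3 ^ k) < 3 ^ k" using assms True pow by linarith
    have "fixed_pt n a i = rev ((tau n ^^ k) [n]) ! nat (- i - 1)"
      using True by (simp add: fixed_pt_def dotted_def left_lim_tau_pow[OF j])
    also have "\<dots> = (tau n ^^ k) [n] ! (3 ^ k - Suc (nat (- i - 1)))"
      using j by (simp add: rev_nth length_tau_pow)
    also have "3 ^ k - Suc (nat (- i - 1)) = nat (i + 3 ^ k)"
      using assms True pow by linarith
    finally show ?thesis using lt by (simp add: split nth_append length_tau_pow)
  next
    case False
    have j: "nat i < 3 ^ k" using assms False pow by linarith
    have eq: "nat (i + 3 ^ k) = 3 ^ k + nat i" using assms False pow by linarith
    show ?thesis
      using False
      by (simp add: fixed_pt_def dotted_def right_lim_tau_pow[OF j] split eq nth_append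
          length_tau_pow)
  qed
qed

lemma fixed_pt_right:
  assumes "j < 3 ^ k"
  shows "fixed_pt n a (int j) = (tau n ^^ k) [a] ! j"
  using right_lim_tau_pow[OF assms] by (simp add: fixed_pt_def dotted_def)

lemma eventually_pow3_window: "\<forall>\<^sub>F k in sequentially. \<bar>i::int\<bar> < 3 ^ k"
proof -
  have "\<bar>i\<bar> < 3 ^ k" if "k \<ge> nat \<bar>i\<bar>" for k
  proof -
    have le: "\<bar>i\<bar> \<le> int k" using that by linarith
    have "k < (3::nat) ^ k" by (induction k) simp_all
    then have "int k < 3 ^ k" by (metis of_nat_less_iff of_nat_numeral of_nat_power)
    with le show ?thesis by linarith
  qed
  then show ?thesis using eventually_sequentially by blast
qed

text \<open>Each factor \<open>\<tau>\<^sup>i(0b)\<close> is what \<open>\<tau>\<^sup>i\<close> of \<open>\<tau>(a) = a0b\<close> adds to \<open>\<tau>\<^sup>i(a)\<close>, so the products that define the rays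
  of \<open>x(n)\<close> and \<open>y(m,n)\<close> are iterates of \<open>\<tau>\<close> on one letter.\<close>

lemma tau_pow_Suc_telescope:
  assumes "tau n [a] = [a, 0, b]"
  shows "[a, 0, b] @ concat (map (\<lambda>i. (tau n ^^ i) [0, b]) [1..<Suc k]) = (tau n ^^ Suc k) [a]"
proof (induction k)
  case (Suc k)
  have "(tau n ^^ Suc (Suc k)) [a] = (tau n ^^ Suc k) ([a] @ [0, b])"
    using assms by (simp add: funpow_Suc_right del: funpow.simps)
  also have "\<dots> = (tau n ^^ Suc k) [a] @ (tau n ^^ Suc k) [0, b]"
    by (rule tau_pow_append)
  finally show ?case using Suc.IH by (simp del: funpow.simps)
qed (simp add: assms)

lemma right_lim_Suc: "right_lim (\<lambda>k. u (Suc k)) = right_lim u"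
  unfolding right_lim_def fun_eq_iff
  by (subst (2) eventually_sequentially_Suc[symmetric]) simp

lemma x_pt_eq: "x_pt n = fixed_pt n n"
proof -
  have "tau n [n] = [n, 0, n]" by (simp add: tau_single)
  from tau_pow_Suc_telescope[OF this] right_lim_Suc[of "\<lambda>k. (tau n ^^ k) [n]"]
  show ?thesis unfolding x_pt_def fixed_pt_def by (simp only:)
qed

lemma y_pt_eq:
  assumes "1 \<le> n" "n \<le> m" shows "y_pt m n = fixed_pt m (n - 1)"
proof -
  have "tau m [n - 1] = [n - 1, 0, n]" using assms by (auto simp: tau_single)
  from tau_pow_Suc_telescope[OF this] right_lim_Suc[of "\<lambda>k. (tau m ^^ k) [n - 1]"]
  show ?thesis unfolding y_pt_def fixed_pt_def by (simp only:)
qed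

section \<open>Membership in the substitution subshifts\<close>

lemma topspace_full_shift: "topspace (full_shift n) = {x. \<forall>i. x i \<in> alph n}"
  by (auto simp: full_shift_def)

lemma limitin_discreteD:
  assumes "limitin (discrete_topology U) f l F" shows "\<forall>\<^sub>F k in F. f k = l"
proof -
  have "openin (discrete_topology U) {l}" using assms by (simp add: limitin_def)
  then have "\<forall>\<^sub>F k in F. f k \<in> {l}" using assms unfolding limitin_def by blast
  then show ?thesis by simp
qed

lemma limitin_full_shift:
  assumes "\<And>k. f k \<in> topspace (full_shift n)"
  shows "limitin (full_shift n) f l sequentially \<longleftrightarrow>
    (\<forall>i. \<forall>\<^sub>F k in sequentially. f k i = l i)"
proof
  assume "limitin (full_shift n) f l sequentially"
  then have lim: "limitin (discrete_topology (alph n)) (\<lambda>k. f k i) (l i) sequentially" for i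
    unfolding full_shift_def limitin_componentwise by blast
  have "\<forall>\<^sub>F k in sequentially. f k i = l i" for i
    using lim by (rule limitin_discreteD)
  then show "\<forall>i. \<forall>\<^sub>F k in sequentially. f k i = l i" ..
next
  assume R: "\<forall>i. \<forall>\<^sub>F k in sequentially. f k i = l i"
  have l: "l i \<in> alph n" for i
  proof -
    obtain k where "f k i = l i"
      using eventually_happens'[OF sequentially_bot R[rule_format, of i]] by blast
    moreover have "f k i \<in> alph n" using assms[of k] by (simp add: topspace_full_shift)
    ultimately show ?thesis by simp
  qed
  have "limitin (discrete_topology (alph n)) (\<lambda>k. f k i) (l i) sequentially" for i
    unfolding limitin_def using l eventually_mono[OF R[rule_format, of i]] by simp
  then show "limitin (full_shift n) f l sequentially"
    using assms unfolding full_shift_def limitin_componentwise by auto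
qed

lemma shift_pow: "(shift ^^ k) x = (\<lambda>i. x (i + int k))"
  by (induction k) (auto simp: shift_def algebra_simps)

text \<open>Negative translations are available because the shift maps \<open>Y\<close> onto \<open>Y\<close>: a point with a prescribed
  image under a power of the shift exists in \<open>Y\<close>, and it can only be the translate.\<close>

lemma translate_in_subshift:
  assumes "shift ` Y = Y" "x \<in> Y"
  shows "(\<lambda>i. x (i + c)) \<in> Y"
proof (cases "c \<ge> 0")
  case True
  have "shift y \<in> Y" if "y \<in> Y" for y using imageI[OF that, of shift] assms(1) by simp
  then have "(shift ^^ k) x \<in> Y" for k
    using assms(2) by (induction k) simp_all
  from this[of "nat c"] show ?thesis using True by (simp add: shift_pow)
next
  case False
  have "\<exists>y\<in>Y. (shift ^^ k) y = x" for k
  proof (induction k)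
    case (Suc k)
    then obtain y where y: "y \<in> Y" "(shift ^^ k) y = x" by blast
    then have "y \<in> shift ` Y" using assms(1) by simp
    then obtain z where z: "z \<in> Y" "y = shift z" by blast
    have "(shift ^^ Suc k) z = x" unfolding funpow_Suc_right using y(2) z(2) by simp
    then show ?case using z(1) by blast
  qed (use assms in simp)
  from this[of "nat (- c)"] obtain y where y: "y \<in> Y" "(shift ^^ nat (- c)) y = x" by blast
  have "x = (\<lambda>i. y (i - c))" using False unfolding y(2)[symmetric] shift_pow by simp
  then show ?thesis using y(1) by simp
qed

lemma appears_in_sublist:
  assumes "appears_in w Y" "sublist v w" shows "appears_in v Y"
proof -
  obtain x i where x: "x \<in> Y" "\<forall>j<length w. x (i + int j) = w ! j"
    using assms(1) unfolding appears_in_def by blast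
  obtain ps ss where w: "w = ps @ v @ ss" using assms(2) unfolding sublist_def by blast
  have "x (i + int (length ps) + int j) = v ! j" if "j < length v" for j
  proof -
    have "length ps + j < length w" using that w by simp
    then have "x (i + int (length ps + j)) = w ! (length ps + j)" using x(2) by blast
    moreover have "w ! (length ps + j) = v ! j" using that w by (simp add: nth_append)
    ultimately show ?thesis by (simp add: add.assoc)
  qed
  then show ?thesis using x(1) unfolding appears_in_def by blast
qed

lemma sublist_tau_pow:
  assumes "sublist v w" shows "sublist ((tau n ^^ k) v) ((tau n ^^ k) w)"
  using assms unfolding sublist_def by (metis tau_pow_append)

text \<open>In each competing subshift \<open>Y\<close> there is, for every \<open>k\<close>, a point that carries \<open>\<tau>\<^sup>k(na)\<close> on the
  coordinates from \<open>-3\<^sup>k\<close> to \<open>3\<^sup>k - 1\<close>; these points converge to the fixed point.\<close>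

lemma fixed_pt_in_Xn:
  assumes "n \<ge> 1" "a \<le> n"
  shows "fixed_pt n a \<in> Xn n"
  unfolding Xn_def
proof (rule InterI, safe)
  fix Y assume Y: "subshift n Y" and words: "\<forall>k. \<forall>a\<in>alph n. appears_in ((tau n ^^ k) [a]) Y"
  obtain K c where Kc: "c \<in> alph n" "sublist [n, a] ((tau n ^^ K) [c])"
    using two_letter_word_occurs[OF assms] by blast
  have "\<exists>y\<in>Y. \<forall>i. \<bar>i\<bar> < 3 ^ k \<longrightarrow> y i = fixed_pt n a i" for k
  proof -
    let ?w = "(tau n ^^ k) [n, a]"
    have "sublist ?w ((tau n ^^ (k + K)) [c])"
      using sublist_tau_pow[OF Kc(2)] by (simp add: funpow_add)
    then have "appears_in ?w Y" using appears_in_sublist words Kc(1) by blast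
    then obtain x s where x: "x \<in> Y" "\<forall>j<length ?w. x (s + int j) = ?w ! j"
      unfolding appears_in_def by blast
    have "x (i + (s + 3 ^ k)) = fixed_pt n a i" if "\<bar>i\<bar> < 3 ^ k" for i
    proof -
      have "nat (i + 3 ^ k) < nat (2 * 3 ^ k)" using that by linarith
      also have "nat (2 * 3 ^ k) = length ?w"
        by (simp add: length_tau_pow nat_mult_distrib nat_power_eq)
      finally have "x (s + int (nat (i + 3 ^ k))) = ?w ! nat (i + 3 ^ k)" using x(2) by blast
      moreover have "fixed_pt n a i = ?w ! nat (i + 3 ^ k)" using that by (intro fixed_pt_window) auto
      moreover have "s + int (nat (i + 3 ^ k)) = i + (s + 3 ^ k)" using that by linarith
      ultimately show ?thesis by (simp only:)
    qed
    moreover have "(\<lambda>i. x (i + (s + 3 ^ k))) \<in> Y"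
      using translate_in_subshift x(1) Y unfolding subshift_def by blast
    ultimately show ?thesis by (intro bexI) auto
  qed
  then obtain f where f: "\<And>k. f k \<in> Y" "\<And>k i. \<bar>i\<bar> < 3 ^ k \<Longrightarrow> f k i = fixed_pt n a i"
    by metis
  have closed: "closedin (full_shift n) Y" using Y unfolding subshift_def by blast
  have ev: "\<forall>\<^sub>F k in sequentially. f k i = fixed_pt n a i" for i
    using eventually_pow3_window[of i] by eventually_elim (rule f(2))
  have "limitin (full_shift n) f (fixed_pt n a) sequentially"
    using ev by (subst limitin_full_shift) (use f(1) closedin_subset[OF closed] in auto)
  then show "fixed_pt n a \<in> Y"
    by (rule limitin_closedin[OF _ closed]) (simp_all add: f(1))
qed

lemma shift_in_Xn:
  assumes "x \<in> Xn n" shows "shift x \<in> Xn n"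
  unfolding Xn_def
proof (rule InterI, safe)
  fix Y assume Y: "subshift n Y" and "\<forall>k. \<forall>a\<in>alph n. appears_in ((tau n ^^ k) [a]) Y"
  then have "x \<in> Y" using assms unfolding Xn_def by blast
  then have "shift x \<in> shift ` Y" by (rule imageI)
  then show "shift x \<in> Y" using Y by (simp add: subshift_def)
qed

section \<open>The inverse limit\<close>

lemma rho_tau: "map (rho n) (tau (n + 1) w) = tau n (map (rho n) w)"
  by (induction w) (auto simp: tau_def tau_letter_def rho_def)

lemma rho_tau_pow: "map (rho n) ((tau (n + 1) ^^ k) w) = (tau n ^^ k) (map (rho n) w)"
  by (induction k) (simp_all only: funpow.simps comp_apply id_apply rho_tau)

text \<open>Identifying \<open>n + 1\<close> with \<open>n\<close> intertwines \<open>\<tau>\<^sub>n\<^sub>+\<^sub>1\<close> and \<open>\<tau>\<^sub>n\<close>, so it maps the window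
  \<open>\<tau>\<^sub>n\<^sub>+\<^sub>1\<^sup>k((n+1)a)\<close> to \<open>\<tau>\<^sub>n\<^sup>k(n\<rho>\<^sub>n(a))\<close>.\<close>

lemma rho_fixed_pt: "rho n \<circ> fixed_pt (n + 1) a = fixed_pt n (rho n a)"
proof
  fix i :: int
  obtain k where k: "\<bar>i\<bar> < 3 ^ k"
    using eventually_happens'[OF sequentially_bot eventually_pow3_window[of i]] by blast
  let ?w = "(tau (n + 1) ^^ k) [n + 1, a]"
  have "nat (i + 3 ^ k) < nat (2 * 3 ^ k)" using k by linarith
  also have "nat (2 * 3 ^ k) = length ?w"
    by (simp add: length_tau_pow nat_mult_distrib nat_power_eq)
  finally have "rho n (?w ! nat (i + 3 ^ k)) = map (rho n) ?w ! nat (i + 3 ^ k)" by simp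
  also have "map (rho n) ?w = (tau n ^^ k) [n, rho n a]"
    unfolding rho_tau_pow by (simp add: rho_def)
  finally show "(rho n \<circ> fixed_pt (n + 1) a) i = fixed_pt n (rho n a) i"
    using k by (simp add: fixed_pt_window[of k] abs_less_iff)
qed

text \<open>The \<open>n\<close>-th element of \<open>S\<close>. The minimum merges the two kinds of entries: below level \<open>n\<close> the seed is
  \<open>m.m\<close>, as in \<open>x(m)\<close>, and from level \<open>n\<close> on it is \<open>m.(n-1)\<close>, as in \<open>y(m,n)\<close>. Compatibility with
  \<open>\<rho>\<close> then reduces to an identity for minima.\<close>

definition S_pt :: "nat \<Rightarrow> nat \<Rightarrow> int \<Rightarrow> nat" where
  "S_pt n = (\<lambda>m\<in>{1..}. fixed_pt m (min m (n - 1)))"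

lemma S_set_eq: "S_set = S_pt ` {2..}"
proof -
  have "(\<lambda>m\<in>{1..}. if m < n then x_pt m else y_pt m n) = S_pt n" if "n \<ge> 2" for n
    unfolding S_pt_def
  proof (rule restrict_ext)
    fix m :: nat assume "m \<in> {1..}"
    then show "(if m < n then x_pt m else y_pt m n) = fixed_pt m (min m (n - 1))"
      using that by (auto simp: x_pt_eq y_pt_eq min_def)
  qed
  then show ?thesis unfolding S_set_def by auto
qed

lemma S_pt_in_X_lim: "S_pt n \<in> X_lim"
proof -
  have "S_pt n \<in> (\<Pi>\<^sub>E m\<in>{1..}. Xn m)"
    by (auto simp: S_pt_def intro: fixed_pt_in_Xn)
  moreover have "rho m \<circ> S_pt n (m + 1) = S_pt n m" if "m \<ge> 1" for m
  proof -
    have "rho m (min (m + 1) (n - 1)) = min m (n - 1)" by (auto simp: rho_def min_def)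
    then show ?thesis using that by (simp add: S_pt_def rho_fixed_pt[simplified])
  qed
  ultimately show ?thesis unfolding X_lim_def by blast
qed

lemma T_lim_in_X_lim:
  assumes "p \<in> X_lim" shows "T_lim p \<in> X_lim"
proof -
  have "T_lim p \<in> (\<Pi>\<^sub>E m\<in>{1..}. Xn m)"
    using assms by (auto simp: T_lim_def X_lim_def intro!: shift_in_Xn)
  moreover have "rho m \<circ> T_lim p (m + 1) = T_lim p m" if "m \<ge> 1" for m
  proof -
    have "rho m \<circ> p (m + 1) = p m" using assms that unfolding X_lim_def by blast
    then show ?thesis using that by (auto simp: T_lim_def shift_def fun_eq_iff)
  qed
  ultimately show ?thesis unfolding X_lim_def by blast
qed

lemma T_lim_pow_in_X_lim: "p \<in> X_lim \<Longrightarrow> (T_lim ^^ k) p \<in> X_lim"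
  by (induction k) (auto intro: T_lim_in_X_lim)

lemma T_lim_pow: "n \<ge> 1 \<Longrightarrow> (T_lim ^^ k) p n i = p n (i + int k)"
  by (induction k arbitrary: i) (auto simp: T_lim_def shift_def algebra_simps)

lemma subshift_full: "subshift n {x. \<forall>i. x i \<in> alph n}"
proof -
  have "x \<in> shift ` {x. \<forall>i. x i \<in> alph n}" if "\<forall>i. x i \<in> alph n" for x
    by (rule image_eqI[of _ _ "\<lambda>i. x (i - 1)"]) (use that in \<open>auto simp: shift_def\<close>)
  moreover have "closedin (full_shift n) {x. \<forall>i. x i \<in> alph n}"
    using closedin_topspace[of "full_shift n"] by (simp add: topspace_full_shift)
  ultimately show ?thesis unfolding subshift_def by (auto simp: shift_def)
qed

lemma appears_in_full:
  assumes "set w \<subseteq> alph n" shows "appears_in w {x. \<forall>i. x i \<in> alph n}"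
proof -
  let ?x = "\<lambda>i::int. if 0 \<le> i \<and> nat i < length w then w ! nat i else 0"
  have "?x i \<in> alph n" for i
    using subsetD[OF assms nth_mem[of "nat i" w]] by (auto simp: alph_def)
  then show ?thesis unfolding appears_in_def
    by (intro bexI[of _ ?x] exI[of _ 0]) auto
qed

text \<open>An empty intersection would be the whole type, which is not a closed subset of the full shift;
  the full shift itself shows that the family is nonempty.\<close>

lemma closedin_Xn: "closedin (full_shift n) (Xn n)"
  unfolding Xn_def
proof (rule closedin_Inter)
  have "appears_in ((tau n ^^ k) [a]) {x. \<forall>i. x i \<in> alph n}" if "a \<in> alph n" for k a
    using that by (intro appears_in_full set_tau_pow) auto
  then show "{Y. subshift n Y \<and> (\<forall>k. \<forall>a\<in>alph n. appears_in ((tau n ^^ k) [a]) Y)} \<noteq> {}"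
    using subshift_full by blast
qed (auto simp: subshift_def)

lemma continuous_eval:
  assumes "n \<ge> 1"
  shows "continuous_map (product_topology (\<lambda>n. subtopology (full_shift n) (Xn n)) {1..})
    (discrete_topology (alph n)) (\<lambda>x. x n i)"
proof -
  have ev: "continuous_map (subtopology (full_shift n) (Xn n)) (discrete_topology (alph n)) (\<lambda>x. x i)"
    unfolding full_shift_def
    by (intro continuous_map_from_subtopology continuous_map_product_projection) simp
  have "continuous_map (product_topology (\<lambda>n. subtopology (full_shift n) (Xn n)) {1..})
      (subtopology (full_shift n) (Xn n)) (\<lambda>x. x n)"
    using assms by (intro continuous_map_product_projection) simp
  from continuous_map_compose[OF this ev] show ?thesis by (simp only: comp_def)
qed

text \<open>By Tychonoff the product of the \<open>X\<^sub>n\<close> is compact. Each compatibility condition at one level and one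
  coordinate equates two continuous maps into a discrete space, so the inverse limit is closed.\<close>

lemma compact_X_lim: "compact_space X_lim_topology"
proof -
  let ?P = "product_topology (\<lambda>n. subtopology (full_shift n) (Xn n)) {1..}"
  have "compact_space (full_shift n)" for n
    by (simp add: full_shift_def compact_space_product_topology compact_space_discrete_topology
        alph_def)
  then have "compact_space (subtopology (full_shift n) (Xn n))" for n
    using closedin_Xn closedin_compact_space compact_space_subtopology by blast
  then have P: "compact_space ?P"
    by (simp add: compact_space_product_topology)
  have space: "topspace ?P = (\<Pi>\<^sub>E n\<in>{1..}. Xn n)"
    using closedin_subset[OF closedin_Xn] by (auto simp: topspace_subtopology PiE_def Pi_def)
  have "closedin ?P {x \<in> topspace ?P. rho n (x (n + 1) i) = x n i}" if "n \<ge> 1" for n i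
  proof (rule closedin_continuous_maps_eq)
    show "Hausdorff_space (discrete_topology (alph n))" by simp
    show "continuous_map ?P (discrete_topology (alph n)) (\<lambda>x. x n i)"
      using that by (rule continuous_eval)
    have rho: "continuous_map (discrete_topology (alph (n + 1))) (discrete_topology (alph n)) (rho n)"
      by (auto simp: alph_def rho_def)
    have "continuous_map ?P (discrete_topology (alph (n + 1))) (\<lambda>x. x (n + 1) i)"
      by (rule continuous_eval) simp
    from continuous_map_compose[OF this rho]
    show "continuous_map ?P (discrete_topology (alph n)) (\<lambda>x. rho n (x (n + 1) i))"
      by (simp only: comp_def)
  qed
  then have "closedin ?P (\<Inter>(n, i)\<in>{1..} \<times> UNIV. {x \<in> topspace ?P. rho n (x (n + 1) i) = x n i})"
    by (intro closedin_Inter) auto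
  also have "(\<Inter>(n, i)\<in>{1..} \<times> UNIV. {x \<in> topspace ?P. rho n (x (n + 1) i) = x n i}) = X_lim"
    unfolding space X_lim_def by (auto simp: fun_eq_iff)
  finally have "compactin ?P X_lim" by (rule closedin_compact_space[OF P])
  then show ?thesis unfolding X_lim_topology_def by (rule compact_space_subtopology)
qed

lemma limitin_X_lim_pointwise:
  assumes "limitin X_lim_topology f l sequentially" "n \<ge> 1"
  shows "\<forall>\<^sub>F k in sequentially. f k n i = l n i"
proof -
  have "limitin (product_topology (\<lambda>n. subtopology (full_shift n) (Xn n)) {1..}) f l sequentially"
    using assms(1) unfolding X_lim_topology_def limitin_subtopology by blast
  from continuous_map_limit[OF continuous_eval[OF assms(2)] this]
  have lim: "limitin (discrete_topology (alph n)) (\<lambda>k. f k n i) (l n i) sequentially"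
    by (simp only: comp_def)
  then show ?thesis by (rule limitin_discreteD)
qed

section \<open>Li--Yorke pairs from coordinates\<close>

text \<open>Sequential compactness, applied to one orbit and then to the other along the subsequence found,
  replaces uniform continuity: coordinates and distances are compared only through the two limits.\<close>

lemma subsequence_limits:
  assumes met: "Metric_space X_lim d"
    and top: "Metric_space.mtopology X_lim d = X_lim_topology"
    and p: "p \<in> X_lim" and q: "q \<in> X_lim"
  obtains r :: "nat \<Rightarrow> nat" and l l' where "strict_mono r" "l \<in> X_lim" "l' \<in> X_lim"
    "\<And>n i. n \<ge> 1 \<Longrightarrow> \<forall>\<^sub>F k in sequentially. p n (i + int (t (r k))) = l n i"
    "\<And>n i. n \<ge> 1 \<Longrightarrow> \<forall>\<^sub>F k in sequentially. q n (i + int (t (r k))) = l' n i"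
    "(\<lambda>k. d ((T_lim ^^ t (r k)) p) ((T_lim ^^ t (r k)) q)) \<longlonglongrightarrow> d l l'"
proof -
  interpret M: Metric_space X_lim d by (rule met)
  have seq: "\<And>\<sigma>::nat \<Rightarrow> _. range \<sigma> \<subseteq> X_lim \<Longrightarrow>
      \<exists>l r. l \<in> X_lim \<and> strict_mono r \<and> limitin X_lim_topology (\<sigma> \<circ> r) l sequentially"
    using M.compact_space_sequentially compact_X_lim unfolding top by blast
  define P where "P = (\<lambda>k. (T_lim ^^ t k) p)"
  define Q where "Q = (\<lambda>k. (T_lim ^^ t k) q)"
  have inX: "P k \<in> X_lim" "Q k \<in> X_lim" for k
    unfolding P_def Q_def by (simp_all add: T_lim_pow_in_X_lim p q)
  obtain l r1 where l: "l \<in> X_lim" "strict_mono r1"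
      "limitin X_lim_topology (P \<circ> r1) l sequentially"
    using seq[of P] inX by blast
  obtain l' r2 where l': "l' \<in> X_lim" "strict_mono r2"
      "limitin X_lim_topology ((Q \<circ> r1) \<circ> r2) l' sequentially"
    using seq[of "Q \<circ> r1"] inX by (metis comp_apply image_subsetI)
  define r where "r = r1 \<circ> r2"
  have r: "strict_mono r" using l(2) l'(2) unfolding r_def by (simp add: strict_mono_o)
  have limP: "limitin X_lim_topology (P \<circ> r) l sequentially"
    using limitin_subsequence[OF l'(2) l(3)] unfolding r_def by (simp add: comp_assoc)
  have limQ: "limitin X_lim_topology (Q \<circ> r) l' sequentially"
    using l'(3) unfolding r_def by (simp add: comp_assoc)
  have dP: "(\<lambda>k. d (P (r k)) l) \<longlonglongrightarrow> 0" and dQ: "(\<lambda>k. d (Q (r k)) l') \<longlonglongrightarrow> 0"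
    using limP limQ unfolding top[symmetric] M.limitin_metric_dist_null by (auto simp: comp_def)
  have "(\<lambda>k. d (P (r k)) (Q (r k)) - d l l') \<longlonglongrightarrow> 0"
  proof (rule Lim_null_comparison)
    show "(\<lambda>k. d (P (r k)) l + d (Q (r k)) l') \<longlonglongrightarrow> 0"
      using tendsto_add[OF dP dQ] by simp
    have "\<bar>d (P (r k)) (Q (r k)) - d l l'\<bar> \<le> d (P (r k)) l + d (Q (r k)) l'" for k
    proof -
      let ?a = "P (r k)" and ?b = "Q (r k)"
      have "d ?a ?b \<le> d ?a l + d l ?b" "d l ?b \<le> d l l' + d l' ?b"
        "d l l' \<le> d l ?a + d ?a l'" "d ?a l' \<le> d ?a ?b + d ?b l'"
        using M.triangle inX l(1) l'(1) by blast+
      moreover have "d l ?a = d ?a l" "d l' ?b = d ?b l'" by (simp_all add: M.commute)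
      ultimately show ?thesis by linarith
    qed
    then show "\<forall>\<^sub>F k in sequentially.
        norm (d (P (r k)) (Q (r k)) - d l l') \<le> d (P (r k)) l + d (Q (r k)) l'"
      by simp
  qed
  then have lim: "(\<lambda>k. d (P (r k)) (Q (r k))) \<longlonglongrightarrow> d l l'" by (simp add: LIM_zero_iff)
  show thesis
  proof (rule that[OF r l(1) l'(1)])
    show "\<forall>\<^sub>F k in sequentially. p n (i + int (t (r k))) = l n i" if "n \<ge> 1" for n i
      using limitin_X_lim_pointwise[OF limP that, of i] that by (simp add: P_def T_lim_pow)
    show "\<forall>\<^sub>F k in sequentially. q n (i + int (t (r k))) = l' n i" if "n \<ge> 1" for n i
      using limitin_X_lim_pointwise[OF limQ that, of i] that by (simp add: Q_def T_lim_pow)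
    show "(\<lambda>k. d ((T_lim ^^ t (r k)) p) ((T_lim ^^ t (r k)) q)) \<longlonglongrightarrow> d l l'"
      using lim unfolding P_def Q_def .
  qed
qed

lemma X_lim_eqI:
  assumes "p \<in> X_lim" "q \<in> X_lim" "\<And>n i. n \<ge> 1 \<Longrightarrow> p n i = q n i"
  shows "p = q"
  using assms unfolding X_lim_def by (intro PiE_ext[of p "{1..}" Xn q]) auto

text \<open>Along the times \<open>t\<close> the two orbits have subsequential limits with equal coordinates, at distance
  zero, which bounds the lower limit. Along the times \<open>s\<close> the limits differ at coordinate zero of
  level \<open>m\<close>, and their positive distance bounds the upper limit from below.\<close>

lemma li_yorkeI:
  fixes s t :: "nat \<Rightarrow> nat"
  assumes met: "Metric_space X_lim d"
    and top: "Metric_space.mtopology X_lim d = X_lim_topology"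
    and p: "p \<in> X_lim" and q: "q \<in> X_lim"
    and t: "strict_mono t"
    and agree: "\<And>n i. n \<ge> 1 \<Longrightarrow> \<forall>\<^sub>F k in sequentially. p n (i + int (t k)) = q n (i + int (t k))"
    and s: "strict_mono s"
    and m: "m \<ge> 1" and differ: "\<And>k. p m (int (s k)) \<noteq> q m (int (s k))"
  shows "li_yorke d T_lim p q"
proof -
  interpret M: Metric_space X_lim d by (rule met)
  define D where "D = (\<lambda>k. ereal (d ((T_lim ^^ k) p) ((T_lim ^^ k) q)))"
  have "limsup D > 0"
  proof -
    obtain r l l' where r: "strict_mono r" and l: "l \<in> X_lim" "l' \<in> X_lim"
      and lp: "\<And>n i. n \<ge> 1 \<Longrightarrow> \<forall>\<^sub>F k in sequentially. p n (i + int (s (r k))) = l n i"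
      and lq: "\<And>n i. n \<ge> 1 \<Longrightarrow> \<forall>\<^sub>F k in sequentially. q n (i + int (s (r k))) = l' n i"
      and lim: "(\<lambda>k. d ((T_lim ^^ s (r k)) p) ((T_lim ^^ s (r k)) q)) \<longlonglongrightarrow> d l l'"
      using subsequence_limits[OF met top p q, of s] by blast
    have "\<forall>\<^sub>F k::nat in sequentially. l m 0 \<noteq> l' m 0"
      using lp[OF m, of 0] lq[OF m, of 0]
      by eventually_elim (use differ in \<open>metis add_0\<close>)
    then have "l \<noteq> l'" by auto
    then have "0 < ereal (d l l')" using l by (simp add: M.mdist_pos_eq)
    also have "ereal (d l l') = limsup (D \<circ> (s \<circ> r))"
      using lim_imp_Limsup[OF sequentially_bot tendsto_ereal[OF lim]]
      unfolding D_def comp_def by simp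
    also have "\<dots> \<le> limsup D"
      by (intro limsup_subseq_mono strict_mono_o s r)
    finally show ?thesis .
  qed
  moreover have "liminf D = 0"
  proof (rule antisym)
    obtain r l l' where r: "strict_mono r" and l: "l \<in> X_lim" "l' \<in> X_lim"
      and lp: "\<And>n i. n \<ge> 1 \<Longrightarrow> \<forall>\<^sub>F k in sequentially. p n (i + int (t (r k))) = l n i"
      and lq: "\<And>n i. n \<ge> 1 \<Longrightarrow> \<forall>\<^sub>F k in sequentially. q n (i + int (t (r k))) = l' n i"
      and lim: "(\<lambda>k. d ((T_lim ^^ t (r k)) p) ((T_lim ^^ t (r k)) q)) \<longlonglongrightarrow> d l l'"
      using subsequence_limits[OF met top p q, of t] by blast
    have "l = l'"
    proof (rule X_lim_eqI[OF l])
      fix n :: nat and i assume n: "n \<ge> 1"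
      have "\<forall>\<^sub>F k::nat in sequentially. l n i = l' n i"
        using lp[OF n, of i] lq[OF n, of i] eventually_subseq[OF r agree[OF n, of i]]
        by eventually_elim simp
      then show "l n i = l' n i" by simp
    qed
    have "liminf D \<le> liminf (D \<circ> (t \<circ> r))"
      by (intro liminf_subseq_mono strict_mono_o t r)
    also have "\<dots> = ereal (d l l')"
      using lim_imp_Liminf[OF sequentially_bot tendsto_ereal[OF lim]]
      unfolding D_def comp_def by simp
    also have "\<dots> = 0" using l \<open>l = l'\<close> by simp
    finally show "liminf D \<le> 0" .
    show "0 \<le> liminf D" by (rule Liminf_bounded) (simp add: D_def)
  qed
  ultimately show ?thesis unfolding li_yorke_def D_def by blast
qed

section \<open>Agreement and disagreement of the fixed points\<close>

text \<open>The right-hand side is free of \<open>a\<close>: in this range of coordinates all fixed points of the same level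
  look alike.\<close>

lemma fixed_pt_middle_block:
  assumes "3 ^ k \<le> j" "j < 2 * 3 ^ k"
  shows "fixed_pt n a (int j) = (tau n ^^ k) [0] ! (j - 3 ^ k)"
proof -
  have "fixed_pt n a (int j) = (tau n ^^ Suc k) [a] ! j"
    using assms by (intro fixed_pt_right) simp
  also have "\<dots> = (tau n ^^ k) [0] ! (j - 3 ^ k)"
  proof -
    have "j - 3 ^ k < 3 ^ k" using assms by linarith
    then show ?thesis
      using assms(1) unfolding tau_pow_Suc_single by (simp add: nth_append length_tau_pow)
  qed
  finally show ?thesis .
qed

lemma fixed_pt_last_block:
  assumes "a < n"
  shows "fixed_pt n a (int (2 * 3 ^ k)) = a + 1"
proof -
  obtain v where v: "(tau n ^^ k) [a + 1] = (a + 1) # v" using tau_pow_hd by blast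
  have "fixed_pt n a (int (2 * 3 ^ k)) = (tau n ^^ Suc k) [a] ! (2 * 3 ^ k)"
    by (intro fixed_pt_right) simp
  also have "\<dots> = a + 1"
    using assms v unfolding tau_pow_Suc_single by (simp add: nth_append length_tau_pow)
  finally show ?thesis .
qed

lemma fixed_pt_eventually_agree:
  "\<forall>\<^sub>F k in sequentially. fixed_pt n a (i + int (3 ^ k + 3 ^ k div 2)) =
     fixed_pt n b (i + int (3 ^ k + 3 ^ k div 2))"
proof -
  \<comment> \<open>The window of radius \<open>\<bar>i\<bar>\<close> around the rounded midpoint lies in the middle block as soon as
    \<open>2 \<bar>i\<bar> + 2 < 3\<^sup>k\<close>; the case distinction moves \<open>2 * i\<close> away from zero by 2.\<close>
  have "\<forall>\<^sub>F k in sequentially. \<bar>2 * i + (if i \<ge> 0 then 2 else - 2)\<bar> < 3 ^ k"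
    by (rule eventually_pow3_window)
  then show ?thesis
  proof eventually_elim
    case (elim k)
    define j where "j = nat (i + int (3 ^ k + 3 ^ k div 2))"
    have "2 * \<bar>i\<bar> + 2 < int (3 ^ k)" using elim by (auto split: if_splits)
    then have j: "3 ^ k \<le> j" "j < 2 * 3 ^ k" "i + int (3 ^ k + 3 ^ k div 2) = int j"
      unfolding j_def by linarith+
    show ?case unfolding j(3) fixed_pt_middle_block[OF j(1,2)] ..
  qed
qed

lemma li_yorke_S_pt:
  assumes "Metric_space X_lim d" "Metric_space.mtopology X_lim d = X_lim_topology"
    and "2 \<le> n" "2 \<le> n'" "n \<noteq> n'"
  shows "li_yorke d T_lim (S_pt n) (S_pt n')"
proof (rule li_yorkeI[OF assms(1,2)])
  show "S_pt n \<in> X_lim" "S_pt n' \<in> X_lim" by (rule S_pt_in_X_lim)+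
  show "strict_mono (\<lambda>k. 3 ^ k + 3 ^ k div 2 :: nat)"
  proof (rule strict_mono_Suc_iff[THEN iffD2], rule allI)
    fix k
    have "(3::nat) ^ k > 0" by simp
    then show "(3::nat) ^ k + 3 ^ k div 2 < 3 ^ Suc k + 3 ^ Suc k div 2"
      unfolding power_Suc by linarith
  qed
  show "strict_mono (\<lambda>k. 2 * 3 ^ k :: nat)"
    by (simp add: strict_mono_Suc_iff)
  show "\<forall>\<^sub>F k in sequentially. S_pt n m (i + int (3 ^ k + 3 ^ k div 2)) =
      S_pt n' m (i + int (3 ^ k + 3 ^ k div 2))" if "m \<ge> 1" for m i
    using that fixed_pt_eventually_agree by (simp add: S_pt_def)
  \<comment> \<open>In the level of the larger index both seeds are below the maximal letter, so that neither
    is capped when it is incremented.\<close>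
  let ?m = "max n n'"
  show "?m \<ge> 1" using assms by simp
  have val: "S_pt c ?m (int (2 * 3 ^ k)) = c" if "2 \<le> c" "c \<le> ?m" for c k
  proof -
    have "min ?m (c - 1) = c - 1" "c - 1 < ?m" "?m \<ge> 1" using that by linarith+
    then show ?thesis using that fixed_pt_last_block[of "c - 1" ?m k] by (simp add: S_pt_def)
  qed
  show "S_pt n ?m (int (2 * 3 ^ k)) \<noteq> S_pt n' ?m (int (2 * 3 ^ k))" for k
    using val[of n k] val[of n' k] assms by simp
qed

theorem proposition4p4:
  fixes d :: "(nat \<Rightarrow> int \<Rightarrow> nat) \<Rightarrow> (nat \<Rightarrow> int \<Rightarrow> nat) \<Rightarrow> real"
  assumes "Metric_space X_lim d"
    and "Metric_space.mtopology X_lim d = X_lim_topology"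
  shows "(\<forall>n\<ge>1. x_pt n \<in> Xn n) \<and> (\<forall>n\<ge>1. \<forall>m\<ge>n. y_pt m n \<in> Xn m) \<and>
    S_set \<subseteq> X_lim \<and> countable S_set \<and> scrambled X_lim d T_lim S_set"
proof (intro conjI)
  show "\<forall>n\<ge>1. x_pt n \<in> Xn n"
    by (simp add: x_pt_eq fixed_pt_in_Xn)
  show "\<forall>n\<ge>1. \<forall>m\<ge>n. y_pt m n \<in> Xn m"
    by (auto simp: y_pt_eq intro!: fixed_pt_in_Xn)
  show sub: "S_set \<subseteq> X_lim"
    unfolding S_set_eq by (auto intro: S_pt_in_X_lim)
  show "countable S_set"
    unfolding S_set_eq by simp
  show "scrambled X_lim d T_lim S_set"
    unfolding scrambled_def
  proof (intro conjI ballI impI)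
    fix p q assume "p \<in> S_set" "q \<in> S_set" "p \<noteq> q"
    then show "li_yorke d T_lim p q"
      unfolding S_set_eq using li_yorke_S_pt[OF assms] by auto
  qed (rule sub)
qed

end
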